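(* Let $g\ge7$ and $q$ be positive integers, and let $\#\mathcal F(g,q,4)$ denote the number of gapsets of genus $g$, depth $q$ and multiplicity $4$. Then $$\#\mathcal F(g,q,4)=\begin{cases} 0, & \text{if } q<\frac g3,\\ 1, & \text{if } q=\frac g3,\\ 3(3q-g), & \text{if } \frac g3<q\le\frac{2g}{5},\\ \frac{3g+4}{5}, & \text{if } q=\frac{2g+1}{5},\\ \frac{3g+8}{5}, & \text{if } q=\frac{2g+2}{5},\\ \frac{3g+12}{5}, & \text{if } q=\frac{2g+3}{5},\\ \frac{3g+11}{5}, & \text{if } q=\frac{2g+4}{5}\text{ and } g\ne 8,\\ \left\lfloor\frac{g+2q}{3}\right\rfloor+2, & \text{if } \frac{2g+4}{5}<q\le\frac{g-1}{2},\\ \left\lfloor\frac{2g+3}{3}\right\rfloor, & \text{if } q=\frac g2,\\ \left\lfloor\frac g3\right\rfloor, & \text{if } q=\frac{g+1}{2},\\ 0, & \text{if } q>\frac{g+1}{2}. \end{cases}$$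
   Context: A gapset is a finite set $G\subset\mathbb N$ (positive integers) such that whenever $z\in G$ and $z=x+y$ with $x,y\in\mathbb N$, then $x\in G$ or $y\in G$. Its genus is $\#G$, its multiplicity is $m(G)=\min\{s\in\mathbb N_0\setminus G: s\ne0\}$, its conductor is $c(G)=\min\{s\in\mathbb N_0: s+n\notin G\ \forall n\in\mathbb N_0\}$, and its depth is $\lceil c(G)/m(G)\rceil$. *)

theory Defs
  imports Complex_Main
begin

definition gapset :: "nat set \<Rightarrow> bool" where
  "gapset G \<longleftrightarrow> finite G \<and> 0 \<notin> G \<and>
     (\<forall>z\<in>G. \<forall>x y. x > 0 \<and> y > 0 \<and> z = x + y \<longrightarrow> x \<in> G \<or> y \<in> G)"

definition genus :: "nat set \<Rightarrow> nat" where
  "genus G = card G"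

definition multiplicity :: "nat set \<Rightarrow> nat" where
  "multiplicity G = (LEAST s. s \<noteq> 0 \<and> s \<notin> G)"

definition conductor :: "nat set \<Rightarrow> nat" where
  "conductor G = (LEAST s. \<forall>n. s + n \<notin> G)"

(* The ceiling is of a nonnegative number, so nat does not truncate. *)
definition depth :: "nat set \<Rightarrow> nat" where
  "depth G = nat \<lceil>real (conductor G) / real (multiplicity G)\<rceil>"

definition gapsets :: "nat \<Rightarrow> nat \<Rightarrow> nat \<Rightarrow> nat set set" where
  "gapsets g q m = {G. gapset G \<and> genus G = g \<and> depth G = q \<and> multiplicity G = m}"

(* The cardinality below is a genuine count: for an element z of a gapset, each pair
   {x, z - x} with 0 < x < z meets the gapset, so a gapset of genus g is contained in
   {1..2 * g - 1} and gapsets g q m is finite. *)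
definition num_gapsets :: "nat \<Rightarrow> nat \<Rightarrow> nat \<Rightarrow> nat" where
  "num_gapsets g q m = card (gapsets g q m)"

end

(* A gapset of multiplicity 4 is determined by its Kunz coordinates (a, b, c): it consists of the
   first a, b, c positive integers congruent to 1, 2, 3 modulo 4.  The gapset property becomes four
   linear inequalities, the genus is a + b + c, and the depth is max a b c.  Triples with
   prescribed sum and maximum split according to whether the maximum is attained by b, else by a,
   else only by c; each class is an interval in the remaining free coordinate.  The cases of
   the theorem record which of the competing endpoints of these three intervals are active. *)

theory Submission
  imports Defs
begin

section \<open>Kunz coordinates for multiplicity 4\<close>

definition kunz_gaps :: "nat \<Rightarrow> nat \<Rightarrow> nat \<Rightarrow> nat set" where
  "kunz_gaps a b c = (\<lambda>j. 4 * j + 1) ` {..<a} \<union> (\<lambda>j. 4 * j + 2) ` {..<b} \<union> (\<lambda>j. 4 * j + 3) ` {..<c}"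

text \<open>The linear conditions are the Kunz inequalities for the residue sums 1+1, 3+3, 1+2 and
  2+3 modulo 4; the summand \<open>1\<close> in two of them is the carry when the residues add up to
  more than 4. Positive coordinates mean that 1, 2, 3 are gaps.\<close>

definition kunz_coords :: "nat \<Rightarrow> nat \<Rightarrow> (nat \<times> nat \<times> nat) set" where
  "kunz_coords g q = {(a, b, c). 1 \<le> a \<and> 1 \<le> b \<and> 1 \<le> c \<and> b \<le> 2 * a \<and> b \<le> 2 * c + 1 \<and>
     c \<le> a + b \<and> a \<le> b + c + 1 \<and> a + b + c = g \<and> max a (max b c) = q}"

lemma mem_kunz_gaps [simp]:
  "4 * j \<notin> kunz_gaps a b c"
  "4 * j + 1 \<in> kunz_gaps a b c \<longleftrightarrow> j < a"
  "4 * j + 2 \<in> kunz_gaps a b c \<longleftrightarrow> j < b"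
  "4 * j + 3 \<in> kunz_gaps a b c \<longleftrightarrow> j < c"
  unfolding kunz_gaps_def image_iff by (auto, presburger+)

lemma nat_mod_4_cases:
  fixes x :: nat
  obtains j where "x = 4 * j" | j where "x = 4 * j + 1" | j where "x = 4 * j + 2" | j where "x = 4 * j + 3"
proof -
  have "x = 4 * (x div 4) \<or> x = 4 * (x div 4) + 1 \<or> x = 4 * (x div 4) + 2 \<or> x = 4 * (x div 4) + 3"
    by presburger
  then show thesis using that by blast
qed

lemma finite_kunz_gaps: "finite (kunz_gaps a b c)"
  by (simp add: kunz_gaps_def)

lemma card_kunz_gaps: "card (kunz_gaps a b c) = a + b + c"
proof -
  have "card ((\<lambda>j::nat. 4 * j + r) ` {..<k}) = k" for r k :: nat
    by (subst card_image) (auto simp: inj_on_def)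
  moreover have "(\<lambda>j::nat. 4 * j + 1) ` {..<a} \<inter> (\<lambda>j. 4 * j + 2) ` {..<b} = {}"
    by (auto, presburger)
  moreover have "((\<lambda>j::nat. 4 * j + 1) ` {..<a} \<union> (\<lambda>j. 4 * j + 2) ` {..<b}) \<inter>
      (\<lambda>j. 4 * j + 3) ` {..<c} = {}"
    by (auto, presburger+)
  ultimately show ?thesis
    unfolding kunz_gaps_def
    by (simp only: card_Un_disjoint finite_UnI finite_imageI finite_lessThan)
qed

lemma kunz_gaps_inject: "kunz_gaps a b c = kunz_gaps a' b' c' \<longleftrightarrow> a = a' \<and> b = b' \<and> c = c'"
proof
  assume eq: "kunz_gaps a b c = kunz_gaps a' b' c'"
  have "j < a \<longleftrightarrow> j < a'" "j < b \<longleftrightarrow> j < b'" "j < c \<longleftrightarrow> j < c'" for j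
    using eq mem_kunz_gaps by metis+
  then show "a = a' \<and> b = b' \<and> c = c'"
    by (metis linorder_neq_iff less_irrefl)
qed simp

text \<open>The gapset property says that positive non-gaps are closed under addition. In the
  classes 1, 2, 3 they start at \<open>4 * a + 1\<close>, \<open>4 * b + 2\<close>,
  \<open>4 * c + 3\<close>, so adding starting points gives all constraints. The sums 1+3 and 2+2
  land on multiples of 4, which are never gaps, and adding a multiple of 4 only moves up within a
  class.\<close>

lemma gapset_kunz_gaps_iff:
  "gapset (kunz_gaps a b c) \<longleftrightarrow>
     b \<le> 2 * a \<and> b \<le> 2 * c + 1 \<and> c \<le> a + b \<and> a \<le> b + c + 1"
proof
  assume gap: "gapset (kunz_gaps a b c)"
  have split: "x + y \<notin> kunz_gaps a b c" if "x \<notin> kunz_gaps a b c" "y \<notin> kunz_gaps a b c" "x > 0" "y > 0" for x y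
    using gap that unfolding gapset_def by blast
  have notin: "4 * a + 1 \<notin> kunz_gaps a b c" "4 * b + 2 \<notin> kunz_gaps a b c" "4 * c + 3 \<notin> kunz_gaps a b c"
    unfolding mem_kunz_gaps by simp_all
  have "(4 * a + 1) + (4 * a + 1) \<notin> kunz_gaps a b c"
    by (intro split[OF notin(1) notin(1)]) simp_all
  moreover have "(4 * a + 1) + (4 * a + 1) = 4 * (2 * a) + 2" by simp
  ultimately have 1: "b \<le> 2 * a" by (simp only: mem_kunz_gaps not_less)
  have "(4 * c + 3) + (4 * c + 3) \<notin> kunz_gaps a b c"
    by (intro split[OF notin(3) notin(3)]) simp_all
  moreover have "(4 * c + 3) + (4 * c + 3) = 4 * (2 * c + 1) + 2" by simp
  ultimately have 2: "b \<le> 2 * c + 1" by (simp only: mem_kunz_gaps not_less)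
  have "(4 * a + 1) + (4 * b + 2) \<notin> kunz_gaps a b c"
    by (intro split[OF notin(1) notin(2)]) simp_all
  moreover have "(4 * a + 1) + (4 * b + 2) = 4 * (a + b) + 3" by simp
  ultimately have 3: "c \<le> a + b" by (simp only: mem_kunz_gaps not_less)
  have "(4 * b + 2) + (4 * c + 3) \<notin> kunz_gaps a b c"
    by (intro split[OF notin(2) notin(3)]) simp_all
  moreover have "(4 * b + 2) + (4 * c + 3) = 4 * (b + c + 1) + 1" by simp
  ultimately have 4: "a \<le> b + c + 1" by (simp only: mem_kunz_gaps not_less)
  show "b \<le> 2 * a \<and> b \<le> 2 * c + 1 \<and> c \<le> a + b \<and> a \<le> b + c + 1"
    using 1 2 3 4 by blast
next
  assume k: "b \<le> 2 * a \<and> b \<le> 2 * c + 1 \<and> c \<le> a + b \<and> a \<le> b + c + 1"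
  \<comment> \<open>Reading membership off residue and quotient reduces closure to sixteen residue
    pairs, each a linear statement about quotients and a carry.\<close>
  have mem: "x \<in> kunz_gaps a b c \<longleftrightarrow> x mod 4 = 1 \<and> x div 4 < a \<or> x mod 4 = 2 \<and> x div 4 < b \<or>
      x mod 4 = 3 \<and> x div 4 < c" for x
  proof -
    have "(4 * j + r) div 4 = j" "(4 * j + r) mod 4 = r" if "r < 4" for j r :: nat
      using that by auto
    from this[of 0] this[of 1] this[of 2] this[of 3] show ?thesis
      by (cases x rule: nat_mod_4_cases) (simp_all only: mem_kunz_gaps, simp_all)
  qed
  have "x \<in> kunz_gaps a b c \<or> y \<in> kunz_gaps a b c" if z: "x + y \<in> kunz_gaps a b c" for x y
  proof (rule ccontr)
    assume "\<not> (x \<in> kunz_gaps a b c \<or> y \<in> kunz_gaps a b c)"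
    then have x: "x \<notin> kunz_gaps a b c" and y: "y \<notin> kunz_gaps a b c" by auto
    define u v where "u = x div 4" and "v = y div 4"
    have "(x + y) mod 4 = (x mod 4 + y mod 4) mod 4" "(x + y) div 4 = u + v + (x mod 4 + y mod 4) div 4"
      unfolding u_def v_def by (rule mod_add_eq[symmetric], rule div_add1_eq)
    moreover have "x mod 4 = 0 \<or> x mod 4 = 1 \<or> x mod 4 = 2 \<or> x mod 4 = 3"
      "y mod 4 = 0 \<or> y mod 4 = 1 \<or> y mod 4 = 2 \<or> y mod 4 = 3"
      by presburger+
    ultimately show False
      using x y z k unfolding mem u_def[symmetric] v_def[symmetric]
      by (elim disjE[of "x mod 4 = _"] disjE[of "y mod 4 = _"]) simp_all
  qed
  moreover have "0 \<notin> kunz_gaps a b c" using mem_kunz_gaps(1)[of 0] by simp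
  ultimately show "gapset (kunz_gaps a b c)"
    unfolding gapset_def using finite_kunz_gaps by blast
qed

section \<open>Multiplicity and depth, and recovery of the coordinates from a gapset\<close>

lemma multiplicity_kunz_gaps:
  assumes "a \<ge> 1" "b \<ge> 1" "c \<ge> 1"
  shows "multiplicity (kunz_gaps a b c) = 4"
  unfolding multiplicity_def
proof (rule Least_equality)
  show "(4::nat) \<noteq> 0 \<and> 4 \<notin> kunz_gaps a b c" using mem_kunz_gaps(1)[of 1] by simp
  show "4 \<le> s" if "s \<noteq> 0 \<and> s \<notin> kunz_gaps a b c" for s
  proof (rule ccontr)
    assume "\<not> 4 \<le> s"
    then have "s \<in> {0, 1, 2, 3}" by auto
    then show False using that assms mem_kunz_gaps(2,3,4)[of 0 a b c, unfolded mult_0_right add_0] by auto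
  qed
qed

text \<open>The exact conductor is not computed. With \<open>q\<close> the maximum, no gap is
  \<open>4 * q\<close> or larger, while a class attaining the maximum has a gap above
  \<open>4 * (q - 1)\<close>. So the conductor lies in the half-open interval from
  \<open>4 * (q - 1)\<close>, excluded, to \<open>4 * q\<close>, included, and the ceiling of its
  quotient by 4 is \<open>q\<close>.\<close>

lemma depth_kunz_gaps:
  assumes "a \<ge> 1" "b \<ge> 1" "c \<ge> 1"
  shows "depth (kunz_gaps a b c) = max a (max b c)"
proof -
  let ?K = "kunz_gaps a b c" and ?q = "max a (max b c)"
  have upper: "\<forall>n. 4 * ?q + n \<notin> ?K"
  proof
    fix n
    show "4 * ?q + n \<notin> ?K"
      by (rule nat_mod_4_cases[of "4 * ?q + n"]) (simp_all only: mem_kunz_gaps, auto)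
  qed
  then have le: "conductor ?K \<le> 4 * ?q"
    unfolding conductor_def by (rule Least_le)
  have above: "\<forall>n. conductor ?K + n \<notin> ?K"
    unfolding conductor_def by (rule LeastI[of "\<lambda>s. \<forall>n. s + n \<notin> ?K", OF upper])
  have "\<exists>r > 0. 4 * (?q - 1) + r \<in> ?K"
  proof -
    consider "?q = a" | "?q = b" | "?q = c" by linarith
    then show ?thesis
    proof cases
      case 1 then show ?thesis using assms by (intro exI[of _ 1]) (simp only: mem_kunz_gaps, simp)
    next
      case 2 then show ?thesis using assms by (intro exI[of _ 2]) (simp only: mem_kunz_gaps, simp)
    next
      case 3 then show ?thesis using assms by (intro exI[of _ 3]) (simp only: mem_kunz_gaps, simp)
    qed
  qed
  then obtain r where r: "4 * (?q - 1) + r \<in> ?K" by blast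
  have gt: "conductor ?K > 4 * (?q - 1)"
  proof (rule ccontr)
    assume "\<not> ?thesis"
    then have "4 * (?q - 1) + r = conductor ?K + (4 * (?q - 1) + r - conductor ?K)" by linarith
    then show False using above r by metis
  qed
  moreover have "?q \<ge> 1" using assms by linarith
  ultimately have "\<lceil>real (conductor ?K) / 4\<rceil> = int ?q"
    using le by (intro ceiling_unique) (auto simp: of_nat_diff)
  then show ?thesis
    unfolding depth_def multiplicity_kunz_gaps[OF assms] by simp
qed

text \<open>Since 4 is not a gap, a gap \<open>x + 4\<close> forces \<open>x\<close> to be a gap.
  Hence the gaps in each residue class form an initial segment, which is finite because
  \<open>G\<close> is.\<close>

lemma gapset_multiplicity_4_kunz:
  assumes gap: "gapset G" and mult: "multiplicity G = 4"
  obtains a b c where "G = kunz_gaps a b c" "a \<ge> 1" "b \<ge> 1" "c \<ge> 1"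
proof -
  have fin: "finite G" and zero: "0 \<notin> G" using gap by (auto simp: gapset_def)
  obtain s where "s \<notin> insert 0 G"
    using ex_new_if_finite[of "insert 0 G"] fin by auto
  then have ex: "s \<noteq> 0 \<and> s \<notin> G" by auto
  have four: "4 \<notin> G"
    using LeastI[of "\<lambda>s. s \<noteq> 0 \<and> s \<notin> G", OF ex] mult unfolding multiplicity_def by auto
  have small: "x \<in> G" if "0 < x" "x < 4" for x
    using not_less_Least[of x "\<lambda>s. s \<noteq> 0 \<and> s \<notin> G"] mult that unfolding multiplicity_def by auto
  have step: "x \<in> G" if "x + 4 \<in> G" for x
    using that gap four zero unfolding gapset_def
    by (metis add_cancel_right_left gr0I zero_less_numeral)
  have down: "4 * j + r \<in> G" if "4 * (j + i) + r \<in> G" for i j r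
    using that
  proof (induction i)
    case (Suc i)
    then show ?case using step[of "4 * (j + i) + r"] by (simp add: algebra_simps)
  qed simp
  have init: "\<exists>k. \<forall>j. 4 * j + r \<in> G \<longleftrightarrow> j < k" for r
  proof -
    have "\<exists>j. 4 * j + r \<notin> G"
    proof (rule ccontr)
      assume "\<not> ?thesis"
      then have "range (\<lambda>j. 4 * j + r) \<subseteq> G" by auto
      then have "finite (range (\<lambda>j::nat. 4 * j + r))" using fin finite_subset by blast
      then have "finite (UNIV :: nat set)" by (rule finite_imageD) (auto simp: inj_on_def)
      then show False by simp
    qed
    \<comment> \<open>The first missing index in the class is its Kunz coordinate; by
      \<open>down\<close>, nothing beyond it can be present.\<close>
    then have not: "4 * (LEAST j. 4 * j + r \<notin> G) + r \<notin> G" by (rule LeastI_ex)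
    have "4 * j + r \<in> G \<longleftrightarrow> j < (LEAST j. 4 * j + r \<notin> G)" for j
    proof
      assume "4 * j + r \<in> G"
      then show "j < (LEAST j. 4 * j + r \<notin> G)"
        using down not by (metis le_add_diff_inverse not_less)
    qed (use not_less_Least in blast)
    then show ?thesis by blast
  qed
  obtain a where a: "\<And>j. 4 * j + 1 \<in> G \<longleftrightarrow> j < a" using init by blast
  obtain b where b: "\<And>j. 4 * j + 2 \<in> G \<longleftrightarrow> j < b" using init by blast
  obtain c where c: "\<And>j. 4 * j + 3 \<in> G \<longleftrightarrow> j < c" using init by blast
  \<comment> \<open>A gap divisible by 4 would descend to 0.\<close>
  have d: "4 * j \<notin> G" for j
    using down[of 0 j 0] zero by auto
  have "x \<in> G \<longleftrightarrow> x \<in> kunz_gaps a b c" for x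
    by (cases x rule: nat_mod_4_cases) (simp_all only: mem_kunz_gaps a b c d)
  moreover have "a \<ge> 1" "b \<ge> 1" "c \<ge> 1"
    using small[of 1] small[of 2] small[of 3] a[of 0] b[of 0] c[of 0]
    unfolding mult_0_right add_0 by simp_all
  ultimately show thesis using that by blast
qed

lemma gapsets_4_eq: "gapsets g q 4 = (\<lambda>(a, b, c). kunz_gaps a b c) ` kunz_coords g q"
proof
  show "gapsets g q 4 \<subseteq> (\<lambda>(a, b, c). kunz_gaps a b c) ` kunz_coords g q"
  proof
    fix G assume "G \<in> gapsets g q 4"
    then have G: "gapset G" "genus G = g" "depth G = q" "multiplicity G = 4"
      by (auto simp: gapsets_def)
    obtain a b c where eq: "G = kunz_gaps a b c" "a \<ge> 1" "b \<ge> 1" "c \<ge> 1"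
      using gapset_multiplicity_4_kunz G by blast
    then have "(a, b, c) \<in> kunz_coords g q"
      using G depth_kunz_gaps[OF eq(2-4)]
      unfolding kunz_coords_def genus_def by (simp add: gapset_kunz_gaps_iff card_kunz_gaps)
    then show "G \<in> (\<lambda>(a, b, c). kunz_gaps a b c) ` kunz_coords g q"
      using eq by force
  qed
  show "(\<lambda>(a, b, c). kunz_gaps a b c) ` kunz_coords g q \<subseteq> gapsets g q 4"
    by (auto simp: kunz_coords_def gapsets_def genus_def gapset_kunz_gaps_iff card_kunz_gaps
        depth_kunz_gaps multiplicity_kunz_gaps)
qed

section \<open>Counting the triples with given sum and maximum\<close>

lemma num_gapsets_4: "num_gapsets g q 4 = card (kunz_coords g q)"
  unfolding num_gapsets_def gapsets_4_eq
  by (rule card_image) (auto simp: inj_on_def kunz_gaps_inject)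

text \<open>With \<open>b = q\<close> maximal, \<open>c \<le> a + b\<close> and
  \<open>a \<le> b + c + 1\<close> are automatic. The bounds on \<open>a\<close> come from
  \<open>q \<le> 2 * a\<close> (half of \<open>q\<close> rounded up), \<open>c \<le> q\<close>,
  \<open>a \<le> q\<close>, and \<open>q \<le> 2 * c + 1\<close> (half of \<open>q\<close> rounded
  down, as a lower bound for \<open>c\<close>).\<close>

lemma mem_kunz_coords_max_2:
  fixes g q :: nat
  assumes "q \<ge> 1"
  shows "(a, q, c) \<in> kunz_coords g q \<longleftrightarrow>
    c = g - q - a \<and> max (max 1 (Suc q div 2)) (g - 2 * q) \<le> a \<and>
    a \<le> min q (g - q - max 1 (q div 2))"
    (is "?L \<longleftrightarrow> ?R")
proof
  assume ?R
  then have "Suc q div 2 \<le> a" and 1: "1 \<le> a" "a \<le> q" and c: "c = g - q - a"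
    and up: "a \<le> g - q - max 1 (q div 2)" and low: "g - 2 * q \<le> a" by simp_all
  then have 2: "q \<le> 2 * a" by linarith
  have "a + max 1 (q div 2) \<le> g - q" using up 1 by linarith
  then have "a + 1 \<le> g - q" "a + q div 2 \<le> g - q" by simp_all
  then have 3: "1 \<le> c" "q div 2 \<le> c" "a + q + c = g" using c by linarith+
  then have "q \<le> 2 * c + 1" "c \<le> q" using low by linarith+
  with 1 2 3 show ?L unfolding kunz_coords_def using assms by simp
next
  assume ?L
  then have R: "1 \<le> a" "1 \<le> c" "q \<le> 2 * a" "q \<le> 2 * c + 1" "a \<le> q" "c \<le> q" "g = a + q + c"
    unfolding kunz_coords_def mem_Collect_eq prod.case by linarith+
  then have "Suc q div 2 \<le> a" "q div 2 \<le> c" by simp_all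
  have "max 1 (q div 2) \<le> c" using R(2) \<open>q div 2 \<le> c\<close> by simp
  then have "a \<le> g - q - max 1 (q div 2)" using R(7) by linarith
  moreover have "g - 2 * q \<le> a" "c = g - q - a" using R by linarith+
  ultimately show ?R using R(1,5) \<open>Suc q div 2 \<le> a\<close> by simp
qed

text \<open>Here \<open>b + c = g - q\<close>, so \<open>q \<le> b + c + 1\<close> no longer
  involves \<open>b\<close> and becomes the guard \<open>2 * q \<le> g + 1\<close>. The bound with
  \<open>div 3\<close> is \<open>b \<le> 2 * c + 1\<close> after eliminating
  \<open>c\<close>.\<close>

lemma mem_kunz_coords_max_1:
  fixes g q :: nat
  assumes "q \<ge> 1"
  shows "b < q \<and> (q, b, c) \<in> kunz_coords g q \<longleftrightarrow>
    c = g - q - b \<and> max 1 (g - 2 * q) \<le> b \<and>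
    b \<le> min (q - 1) (min ((2 * (g - q) + 1) div 3) (g - q - 1)) \<and> 2 * q \<le> g + 1"
    (is "?L \<longleftrightarrow> ?R")
proof
  assume ?R
  then have "3 * b \<le> 2 * (g - q) + 1" "1 \<le> b" "g - 2 * q \<le> b" "b \<le> q - 1" "b \<le> g - q - 1"
    "2 * q \<le> g + 1" "c = g - q - b"
    by (simp_all add: less_eq_div_iff_mult_less_eq)
  then have "1 \<le> b" "b < q" "1 \<le> c" "q + b + c = g" "b \<le> 2 * c + 1" "c \<le> q" "2 * q \<le> g + 1"
    using assms by linarith+
  then show ?L unfolding kunz_coords_def by simp
next
  assume ?L
  then have "1 \<le> b" "1 \<le> c" "b < q" "b \<le> 2 * c + 1" "c \<le> q" "g = q + b + c" "q \<le> b + c + 1"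
    unfolding kunz_coords_def mem_Collect_eq prod.case by linarith+
  then have "b \<le> q - 1" "g - 2 * q \<le> b" "3 * b \<le> 2 * (g - q) + 1" "b \<le> g - q - 1"
    "c = g - q - b" "2 * q \<le> g + 1" "1 \<le> b"
    by linarith+
  then show ?R by (simp add: less_eq_div_iff_mult_less_eq)
qed

text \<open>Now \<open>q \<le> a + b\<close> turns into the guard \<open>2 * q \<le> g\<close>, and
  the bound with \<open>div 3\<close> is \<open>b \<le> 2 * a\<close>. The strict
  \<open>a < q\<close> raises the lower endpoint by one, hence \<open>Suc g\<close>.\<close>

lemma mem_kunz_coords_max_3:
  fixes g q :: nat
  assumes "q \<ge> 1"
  shows "a < q \<and> b < q \<and> (a, b, q) \<in> kunz_coords g q \<longleftrightarrow>
    a = g - q - b \<and> max 1 (Suc g - 2 * q) \<le> b \<and>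
    b \<le> min (q - 1) (min (2 * (g - q) div 3) (g - q - 1)) \<and> 2 * q \<le> g"
    (is "?L \<longleftrightarrow> ?R")
proof
  assume ?R
  then have "b \<le> 2 * (g - q) div 3" "1 \<le> b" "Suc g - 2 * q \<le> b" "b \<le> q - 1" "2 * q \<le> g"
    "a = g - q - b"
    by simp_all
  then have "1 \<le> b" "b < q" "1 \<le> a" "a + b + q = g" "b \<le> 2 * a" "a < q" "2 * q \<le> g"
    using assms by linarith+
  then show ?L unfolding kunz_coords_def by simp
next
  assume ?L
  then have "1 \<le> a" "1 \<le> b" "b < q" "a < q" "b \<le> 2 * a" "g = a + b + q" "q \<le> a + b"
    unfolding kunz_coords_def mem_Collect_eq prod.case by simp_all
  then have "b \<le> q - 1" "Suc g - 2 * q \<le> b" "3 * b \<le> 2 * (g - q)" "b \<le> g - q - 1"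
    "a = g - q - b" "2 * q \<le> g" "1 \<le> b"
    by linarith+
  then show ?R by (simp add: less_eq_div_iff_mult_less_eq)
qed

text \<open>Ties for the maximum are resolved in the order \<open>b\<close>, \<open>a\<close>,
  \<open>c\<close>, which makes the three classes disjoint. Each is the injective image of an
  interval; truncated subtraction in \<open>Suc u - l\<close> gives 0 for an empty one.\<close>

lemma card_kunz_coords:
  fixes g q :: nat
  assumes "q \<ge> 1"
  defines "l1 \<equiv> max (max 1 (Suc q div 2)) (g - 2 * q)"
    and "u1 \<equiv> min q (g - q - max 1 (q div 2))"
    and "l2 \<equiv> max 1 (g - 2 * q)"
    and "u2 \<equiv> min (q - 1) (min ((2 * (g - q) + 1) div 3) (g - q - 1))"
    and "l3 \<equiv> max 1 (Suc g - 2 * q)"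
    and "u3 \<equiv> min (q - 1) (min (2 * (g - q) div 3) (g - q - 1))"
  shows "card (kunz_coords g q) = (Suc u1 - l1) +
    (if 2 * q \<le> g + 1 then Suc u2 - l2 else 0) + (if 2 * q \<le> g then Suc u3 - l3 else 0)"
proof -
  define A where "A = (\<lambda>a. (a, q, g - q - a)) ` {l1..u1}"
  define B where "B = (if 2 * q \<le> g + 1 then (\<lambda>b. (q, b, g - q - b)) ` {l2..u2} else {})"
  define C where "C = (if 2 * q \<le> g then (\<lambda>b. (g - q - b, b, q)) ` {l3..u3} else {})"
  have memA: "(a, b, c) \<in> A \<longleftrightarrow> b = q \<and> (a, b, c) \<in> kunz_coords g q" for a b c
    unfolding A_def using mem_kunz_coords_max_2[OF assms(1), of a c g, folded l1_def u1_def] by auto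
  have memB: "(a, b, c) \<in> B \<longleftrightarrow> a = q \<and> b < q \<and> (a, b, c) \<in> kunz_coords g q" for a b c
    unfolding B_def using mem_kunz_coords_max_1[OF assms(1), of b c g, folded l2_def u2_def] by auto
  have memC: "(a, b, c) \<in> C \<longleftrightarrow> c = q \<and> a < q \<and> b < q \<and> (a, b, c) \<in> kunz_coords g q" for a b c
    unfolding C_def using mem_kunz_coords_max_3[OF assms(1), of a b g, folded l3_def u3_def] by auto
  have max: "a = q \<or> b = q \<or> c = q" "a \<le> q" "b \<le> q" if "(a, b, c) \<in> kunz_coords g q" for a b c
    using that by (auto simp: kunz_coords_def)
  have "kunz_coords g q = A \<union> B \<union> C"
  proof (intro set_eqI, clarify)
    fix a b c
    show "(a, b, c) \<in> kunz_coords g q \<longleftrightarrow> (a, b, c) \<in> A \<union> B \<union> C"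
      using memA[of a b c] memB[of a b c] memC[of a b c] max[of a b c] by (auto simp: le_less)
  qed
  moreover have "finite A" "finite B" "finite C" by (auto simp: A_def B_def C_def)
  moreover have "A \<inter> B = {}" "(A \<union> B) \<inter> C = {}" using memA memB memC by auto
  ultimately have "card (kunz_coords g q) = card A + card B + card C"
    by (simp add: card_Un_disjoint)
  moreover have "card A = Suc u1 - l1"
    unfolding A_def by (subst card_image) (auto simp: inj_on_def)
  moreover have "card B = (if 2 * q \<le> g + 1 then Suc u2 - l2 else 0)"
    unfolding B_def by (auto simp: card_image inj_on_def)
  moreover have "card C = (if 2 * q \<le> g then Suc u3 - l3 else 0)"
    unfolding C_def by (auto simp: card_image inj_on_def)
  ultimately show ?thesis by simp
qed

section \<open>Evaluating the count in each range of \<open>q\<close>\<close>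

theorem theorem7p2:
  fixes g q :: nat
  assumes "g \<ge> 7" and "q \<ge> 1"
  shows
    "(real q < real g / 3 \<longrightarrow> num_gapsets g q 4 = 0) \<and>
     (real q = real g / 3 \<longrightarrow> num_gapsets g q 4 = 1) \<and>
     (real g / 3 < real q \<and> real q \<le> 2 * real g / 5 \<longrightarrow>
        real (num_gapsets g q 4) = 3 * (3 * real q - real g)) \<and>
     (real q = (2 * real g + 1) / 5 \<longrightarrow>
        real (num_gapsets g q 4) = (3 * real g + 4) / 5) \<and>
     (real q = (2 * real g + 2) / 5 \<longrightarrow>
        real (num_gapsets g q 4) = (3 * real g + 8) / 5) \<and>
     (real q = (2 * real g + 3) / 5 \<longrightarrow>
        real (num_gapsets g q 4) = (3 * real g + 12) / 5) \<and>
     (real q = (2 * real g + 4) / 5 \<and> g \<noteq> 8 \<longrightarrow>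
        real (num_gapsets g q 4) = (3 * real g + 11) / 5) \<and>
     ((2 * real g + 4) / 5 < real q \<and> real q \<le> (real g - 1) / 2 \<longrightarrow>
        int (num_gapsets g q 4) = \<lfloor>(real g + 2 * real q) / 3\<rfloor> + 2) \<and>
     (real q = real g / 2 \<longrightarrow>
        int (num_gapsets g q 4) = \<lfloor>(2 * real g + 3) / 3\<rfloor>) \<and>
     (real q = (real g + 1) / 2 \<longrightarrow>
        int (num_gapsets g q 4) = \<lfloor>real g / 3\<rfloor>) \<and>
     (real q > (real g + 1) / 2 \<longrightarrow> num_gapsets g q 4 = 0)"
proof -
  note g = assms(1)
  define l1 u1 l2 u2 l3 u3
    where "l1 = max (max 1 (Suc q div 2)) (g - 2 * q)"
      and "u1 = min q (g - q - max 1 (q div 2))"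
      and "l2 = max 1 (g - 2 * q)"
      and "u2 = min (q - 1) (min ((2 * (g - q) + 1) div 3) (g - q - 1))"
      and "l3 = max 1 (Suc g - 2 * q)"
      and "u3 = min (q - 1) (min (2 * (g - q) div 3) (g - q - 1))"
  note defs = this
  define N where "N = num_gapsets g q 4"
  have N: "N = (Suc u1 - l1) + (if 2 * q \<le> g + 1 then Suc u2 - l2 else 0) +
      (if 2 * q \<le> g then Suc u3 - l3 else 0)"
    unfolding N_def num_gapsets_4 card_kunz_coords[OF assms(2)] defs ..
  \<comment> \<open>Here \<open>g - 2 * q\<close> exceeds \<open>q\<close>, so every lower endpoint
    lies beyond its upper one.\<close>
  have 1: "N = 0" if "3 * q < g"
    using N that unfolding defs by simp
  \<comment> \<open>Only the triple with all coordinates equal to \<open>q\<close> survives.\<close>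
  have 2: "N = 1" if "3 * q = g"
    using N that g unfolding defs by auto
  \<comment> \<open>The condition \<open>5 * q \<le> 2 * g\<close> says that half of
    \<open>q\<close> is at most \<open>g - 2 * q\<close>, so the halving and \<open>div 3\<close>
    bounds are inactive. The class sizes are \<open>3 * q - g\<close> plus 1, 0 and -1.\<close>
  have 3: "N + 3 * g = 9 * q" if "g < 3 * q" "5 * q \<le> 2 * g"
  proof -
    have "l1 = g - 2 * q" "u1 = q" "l2 = g - 2 * q" "u2 = q - 1" "l3 = g - 2 * q + 1" "u3 = q - 1"
      unfolding defs using that g by linarith+
    then show ?thesis using N that by simp
  qed
  have 4: "5 * N = 3 * g + 4" if "5 * q = 2 * g + 1"
  proof -
    \<comment> \<open>The equation fixes the parity of \<open>q\<close>. Writing \<open>q\<close>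
      and \<open>g\<close> through \<open>t\<close> makes every endpoint linear in \<open>t\<close>;
      the next three cases proceed alike.\<close>
    have "q = 2 * (q div 2) + 1" using that by presburger
    then obtain t where t: "q = 2 * t + 1" by blast
    then have gt: "g = 5 * t + 2" "t \<ge> 1" using that g by auto
    with t have "l1 = t + 1" "u1 = 2 * t + 1" "l2 = t" "u2 = 2 * t" "l3 = t + 1" "u3 = 2 * t"
      unfolding defs by auto
    then show ?thesis using N gt by (simp add: t)
  qed
  have 5: "5 * N = 3 * g + 8" if "5 * q = 2 * g + 2"
  proof -
    have "2 dvd q" using that by presburger
    moreover have "q \<ge> 2" using that g by linarith
    ultimately have "q = 2 * (q div 2 - 1) + 2" by auto
    then obtain t where t: "q = 2 * t + 2" by blast
    then have gt: "g = 5 * t + 4" "t \<ge> 1" using that g by auto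
    with t have "l1 = t + 1" "u1 = 2 * t + 1" "l2 = t" "u2 = 2 * t + 1" "l3 = t + 1" "u3 = 2 * t + 1"
      unfolding defs by auto
    then show ?thesis using N gt by (simp add: t)
  qed
  have 6: "5 * N = 3 * g + 12" if "5 * q = 2 * g + 3"
  proof -
    have "q = 2 * (q div 2) + 1" using that by presburger
    then obtain t where t: "q = 2 * t + 1" by blast
    \<comment> \<open>The value \<open>t = 1\<close> would mean \<open>g = 6\<close>;
      \<open>t \<ge> 2\<close> keeps \<open>g - 2 * q = t - 1\<close> positive, so that it is
      \<open>l2\<close>.\<close>
    then have gt: "g = 5 * t + 1" "t \<ge> 2" using that g by auto
    with t have "l1 = t + 1" "u1 = 2 * t" "l2 = t - 1" "u2 = 2 * t" "l3 = t" "u3 = 2 * t"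
      unfolding defs by auto
    then show ?thesis using N gt by (simp add: t)
  qed
  have 7: "5 * N = 3 * g + 11" if "5 * q = 2 * g + 4" "g \<noteq> 8"
  proof -
    have "2 dvd q" using that by presburger
    moreover have "q \<ge> 2" using that g by linarith
    ultimately have "q = 2 * (q div 2 - 1) + 2" by auto
    then obtain t where t: "q = 2 * t + 2" by blast
    then have gt: "g = 5 * t + 3" using that by simp
    \<comment> \<open>The excluded \<open>g = 8\<close> is \<open>t = 1\<close>: there
      \<open>g = 2 * q\<close>, and the bound 1 in \<open>l2\<close> overrides
      \<open>t - 1 = 0\<close>.\<close>
    then have "t \<noteq> 0" "t \<noteq> 1" using that g by auto
    then have "t \<ge> 2" by linarith
    with t gt have "l1 = t + 1" "u1 = 2 * t" "l2 = t - 1" "u2 = 2 * t + 1" "l3 = t" "u3 = 2 * t"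
      unfolding defs by auto
    then show ?thesis using N gt \<open>t \<ge> 2\<close> by (simp add: t)
  qed
  have 8: "N = (g + 2 * q) div 3 + 2" if "2 * g + 4 < 5 * q" "2 * q + 1 \<le> g"
  proof -
    have "q \<le> g" using that by linarith
    \<comment> \<open>\<open>n\<close> is the sum of the two coordinates other than the one equal to
      \<open>q\<close>, and \<open>g - 2 * q\<close> becomes \<open>n - q\<close>.\<close>
    then obtain n where n: "g = q + n" using le_Suc_ex by blast
    have "g - 2 * q \<le> Suc q div 2" "1 \<le> q div 2"
      using that g by linarith+
    then have 1: "l1 = Suc q div 2" "l2 = g - 2 * q" "l3 = g - 2 * q + 1"
      unfolding defs using that(2) by simp_all
    have "n \<le> q + q div 2" "q < n"
      using that n by linarith+
    then have "u1 = n - q div 2"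
      unfolding defs n using \<open>1 \<le> q div 2\<close> by simp
    moreover have "Suc q div 2 = q - q div 2" by presburger
    ultimately have count1: "Suc u1 - l1 = Suc (n - q)"
      using \<open>q < n\<close> 1(1) by simp
    have "(2 * n + 1) div 3 \<le> q - 1" "(2 * n + 1) div 3 \<le> n - 1"
      "2 * n div 3 \<le> q - 1" "2 * n div 3 \<le> n - 1"
      using that g n by linarith+
    then have "u2 = (2 * n + 1) div 3" "u3 = 2 * n div 3"
      unfolding defs n by simp_all
    moreover have "n - q \<le> (2 * n + 1) div 3" "n - q \<le> 2 * n div 3"
      using that n by linarith+
    ultimately have counts: "Suc u2 - l2 + (n - q) = Suc ((2 * n + 1) div 3)"
      "Suc u3 - l3 + (n - q) = 2 * n div 3"
      unfolding 1 n by simp_all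
    have "N = (Suc u1 - l1) + (Suc u2 - l2) + (Suc u3 - l3)"
      using N that(2) by simp
    \<comment> \<open>The second and third intervals start at \<open>n - q\<close> and
      \<open>n - q + 1\<close>, so adding \<open>n - q\<close> to each size leaves only upper
      endpoints. One copy is added to \<open>N\<close>; the other comes from the first class, of
      size \<open>Suc (n - q)\<close>.\<close>
    then have "N + (n - q) = Suc ((Suc u2 - l2 + (n - q)) + (Suc u3 - l3 + (n - q)))"
      unfolding count1 by linarith
    then have "N + (n - q) = 2 + ((2 * n + 1) div 3 + 2 * n div 3)"
      unfolding counts by simp
    moreover have "(2 * n + 1) div 3 + 2 * n div 3 = (4 * n) div 3" by presburger
    ultimately have "N + n = q + 2 + (4 * n) div 3" using \<open>q < n\<close> by simp
    moreover have "(g + 2 * q) div 3 + n = q + (4 * n) div 3" unfolding n by presburger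
    ultimately show ?thesis by simp
  qed
  have 9: "N = (2 * g + 3) div 3" if "2 * q = g"
  proof -
    have "q div 2 \<le> q" "1 \<le> q div 2" "(2 * q + 1) div 3 \<le> q - 1" "2 * q div 3 \<le> q - 1"
      using that g by linarith+
    moreover have "g = q + q" using that by simp
    \<comment> \<open>Since \<open>g - 2 * q = 0\<close>, positivity now determines
      \<open>l2\<close>, and the first class shrinks to a single triple.\<close>
    ultimately have "l1 = Suc q div 2" "u1 = q - q div 2" "l2 = 1" "u2 = (2 * q + 1) div 3"
      "l3 = 1" "u3 = 2 * q div 3"
      unfolding defs by simp_all
    moreover have "Suc (q - q div 2) - Suc q div 2 = 1" by presburger
    ultimately have "N = 1 + ((2 * q + 1) div 3 + 2 * q div 3)" using N that by simp
    moreover have "(2 * q + 1) div 3 + 2 * q div 3 = (4 * q) div 3" by presburger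
    ultimately show ?thesis using that by simp
  qed
  have 10: "N = g div 3" if "2 * q = g + 1"
  proof -
    have "q \<ge> 4" "g = q + (q - 1)" using that g by linarith+
    moreover from this have "1 \<le> q div 2" "(2 * (q - 1) + 1) div 3 \<le> q - 1 - 1" by linarith+
    \<comment> \<open>The third class is ruled out by its guard and the first is empty, its
      endpoints missing each other by one; only the second contributes.\<close>
    ultimately have "l1 = Suc q div 2" "u1 = q - 1 - q div 2" "l2 = 1" "u2 = (2 * (q - 1) + 1) div 3"
      unfolding defs by simp_all
    moreover have "Suc (q - 1 - q div 2) - Suc q div 2 = 0" using \<open>q \<ge> 4\<close> by presburger
    moreover have "2 * (q - 1) + 1 = g" using that by simp
    ultimately show ?thesis using N that by simp
  qed
  have 11: "N = 0" if "g + 1 < 2 * q"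
  proof -
    have "1 \<le> q div 2" using that g by linarith
    then have "u1 \<le> g - q - q div 2" "Suc q div 2 \<le> l1"
      unfolding defs by simp_all
    \<comment> \<open>Both guards fail, and the first class would need \<open>a + c \<ge> q\<close>,
      whereas \<open>a + c = g - q\<close> is smaller.\<close>
    moreover have "Suc q div 2 + q div 2 = q" by presburger
    ultimately have "u1 < l1" using that g by linarith
    then show ?thesis using N that by simp
  qed
  have floor: "\<lfloor>(real g + 2 * real q) / 3\<rfloor> = int ((g + 2 * q) div 3)"
    "\<lfloor>(2 * real g + 3) / 3\<rfloor> = int ((2 * g + 3) div 3)"
    "\<lfloor>real g / 3\<rfloor> = int (g div 3)"
    using floor_divide_of_nat_eq[of "g + 2 * q" 3, where ?'a = real]
      floor_divide_of_nat_eq[of "2 * g + 3" 3, where ?'a = real]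
      floor_divide_of_nat_eq[of g 3, where ?'a = real] by simp_all
  \<comment> \<open>It remains to clear denominators and pass from real hypotheses to the
    natural-number cases.\<close>
  show ?thesis
    unfolding N_def[symmetric] floor
  proof (intro conjI impI)
    show "N = 0"
      if "real q < real g / 3"
    proof -
      have "3 * q < g" using that by linarith
      from 1[OF this] show ?thesis by simp
    qed
    show "N = 1"
      if "real q = real g / 3"
    proof -
      have "3 * q = g" using that by (intro of_nat_eq_iff[where 'a = real, THEN iffD1]) simp
      from 2[OF this] show ?thesis by simp
    qed
    show "real N = 3 * (3 * real q - real g)"
      if "real g / 3 < real q \<and> real q \<le> 2 * real g / 5"
    proof -
      have "g < 3 * q" "5 * q \<le> 2 * g" using that by linarith+
      from arg_cong[OF 3[OF this], of real] show ?thesis by simp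
    qed
    show "real N = (3 * real g + 4) / 5"
      if "real q = (2 * real g + 1) / 5"
    proof -
      have "5 * q = 2 * g + 1" using that by (intro of_nat_eq_iff[where 'a = real, THEN iffD1]) simp
      from arg_cong[OF 4[OF this], of real] show ?thesis by simp
    qed
    show "real N = (3 * real g + 8) / 5"
      if "real q = (2 * real g + 2) / 5"
    proof -
      have "5 * q = 2 * g + 2" using that by (intro of_nat_eq_iff[where 'a = real, THEN iffD1]) simp
      from arg_cong[OF 5[OF this], of real] show ?thesis by simp
    qed
    show "real N = (3 * real g + 12) / 5"
      if "real q = (2 * real g + 3) / 5"
    proof -
      have "5 * q = 2 * g + 3" using that by (intro of_nat_eq_iff[where 'a = real, THEN iffD1]) simp
      from arg_cong[OF 6[OF this], of real] show ?thesis by simp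
    qed
    show "real N = (3 * real g + 11) / 5"
      if "real q = (2 * real g + 4) / 5 \<and> g \<noteq> 8"
    proof -
      have "5 * q = 2 * g + 4" using that by (intro of_nat_eq_iff[where 'a = real, THEN iffD1]) simp
      from arg_cong[OF 7[OF this conjunct2[OF that]], of real] show ?thesis by simp
    qed
    show "int N = int ((g + 2 * q) div 3) + 2"
      if "(2 * real g + 4) / 5 < real q \<and> real q \<le> (real g - 1) / 2"
    proof -
      have "real (2 * g + 4) < real (5 * q)" "real (2 * q + 1) \<le> real (g)" using that by (simp_all add: field_simps)
      then have "2 * g + 4 < 5 * q" "2 * q + 1 \<le> g" unfolding of_nat_less_iff of_nat_le_iff by simp_all
      from 8[OF this] show ?thesis by simp
    qed
    show "int N = int ((2 * g + 3) div 3)"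
      if "real q = real g / 2"
    proof -
      have "2 * q = g" using that by (intro of_nat_eq_iff[where 'a = real, THEN iffD1]) simp
      from 9[OF this] show ?thesis by simp
    qed
    show "int N = int (g div 3)"
      if "real q = (real g + 1) / 2"
    proof -
      have "2 * q = g + 1" using that by (intro of_nat_eq_iff[where 'a = real, THEN iffD1]) simp
      from 10[OF this] show ?thesis by simp
    qed
    show "N = 0"
      if "real q > (real g + 1) / 2"
    proof -
      have "real (g + 1) < real (2 * q)" using that by (simp_all add: field_simps)
      then have "g + 1 < 2 * q" unfolding of_nat_less_iff of_nat_le_iff .
      from 11[OF this] show ?thesis by simp
    qed
  qed
qed

end
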